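(* For all positive integers $m,n$ and every $v \in \mathbb{Z}$, $$ P\left[\mathrm{lk}\left(L_{2m,2n}\right) = v\right] \;\leq\; \frac{6}{\sqrt{\min(m,n)}} , $$ where $L_{2m,2n}$ is the random two-component link of the Petaluma model with $2m$ and $2n$ petals in its components, and $\mathrm{lk}$ is the linking number.
   Context: The $(2m,2n)$-petal diagram is the following pair of oriented closed planar curves. The first component has $2m$ straight arcs, which are diameters of the unit disk at angles $0<\alpha_1<\dots<\alpha_{2m}<\pi/2$ (with endpoints at angles $\alpha_j$ and $\alpha_j+\pi$), and the second has $2n$ straight arcs, which are diameters at angles $\pi/2<\beta_1<\dots<\beta_{2n}<\pi$. All straight arcs pass through the origin. Outside the disk the endpoints of the first component's arcs are joined by $2m$ pairwise disjoint petals: the points at angles $\alpha_{2j-1}+\pi$ and $\alpha_{2j}+\pi$ are joined for $1\le j\le m$; the points at angles $\alpha_{2j}$ and $\alpha_{2j+1}$ are joined for $1\le j\le m-1$; and one large outer petal, encompassing the latter ones, joins the points at angles $\alpha_1$ and $\alpha_{2m}$. Each petal lies in the sector between the two angles it joins. The component is oriented so that the outer petal is travelled from angle $\alpha_1$ to angle $\alpha_{2m}$; thus after the outer petal one travels the arcs in the order $\alpha_{2m},\alpha_{2m-1},\dots,\alpha_1$, in alternating directions, the first being travelled from its endpoint at angle $\alpha_{2m}$ to its endpoint at angle $\alpha_{2m}+\pi$. The second component is constructed and oriented in exactly the same way with $\beta$'s and $n$ in place of $\alpha$'s and $m$. The petals of the two components are disjoint, so the origin is the only multiple point. Number the straight arcs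 of the first component $1,\dots,2m$ and those of the second $2m+1,\dots,2m+2n$, in the order of travel just described. For $\pi\in S_{2m+2n}$, $L_{2m,2n}(\pi)$ is the oriented two-component link in $\mathbb{R}^3$ represented by curves projecting onto this diagram, with the $i$-th straight arc at height $\pi(i)$. The random link $L_{2m,2n}$ is $L_{2m,2n}(\pi)$ for a uniformly random $\pi\in S_{2m+2n}$. The linking number $\mathrm{lk}(L)$ of an oriented two-component link is half the number of positive crossings minus half the number of negative crossings in a diagram of $L$, where only crossings between the two components are counted. For petal links this gives $$ \mathrm{lk}(L_{2m,2n}(\pi)) = \tfrac12 \sum_{i=1}^{2m}\;\sum_{j=2m+1}^{2m+2n} (-1)^{i+j}\,\mathrm{sign}(\pi(i)-\pi(j)). $$ *)

theory Defs
  imports "HOL-Probability.Probability" "HOL-Combinatorics.Permutations"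
begin

text \<open>
  We model $3$-space as \<^typ>\<open>complex \<times> real\<close>: the first factor is the plane of the diagrams and
  the second one is the height above it. Closed curves are parametrised by the unit interval.
\<close>

type_synonym planar_curve = "real \<Rightarrow> complex"
type_synonym planar_diagram = "planar_curve \<times> planar_curve"
type_synonym space_curve = "real \<Rightarrow> complex \<times> real"
type_synonym link = "space_curve \<times> space_curve"

definition closed_curve :: "(real \<Rightarrow> 'a::topological_space) \<Rightarrow> bool" where
  "closed_curve g \<longleftrightarrow> path g \<and> pathfinish g = pathstart g"


subsection \<open>The linking number\<close>

text \<open>
  A crossing is a pair of parameters, i.e. a pair of strands meeting in the projection, and not a
  point of the plane. Hence at a multiple point of the diagram every pair of strands taken from the
  two components is one crossing, just as in any generic resolution of the multiple point. The
  parameter \<open>1\<close> is left out since it denotes the same point of a closed curve as \<open>0\<close>.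
\<close>

definition crossings :: "link \<Rightarrow> (real \<times> real) set" where
  "crossings K = {(s, t). s \<in> {0..<1} \<and> t \<in> {0..<1} \<and> fst (fst K s) = fst (snd K t)}"

definition planar_tangent :: "space_curve \<Rightarrow> real \<Rightarrow> complex" where
  "planar_tangent k t = vector_derivative (fst \<circ> k) (at t)"

text \<open>\<open>Im (cnj a * b)\<close> is the determinant of the plane vectors \<open>a\<close> and \<open>b\<close>.\<close>

definition planar_det :: "complex \<Rightarrow> complex \<Rightarrow> real" where
  "planar_det a b = Im (cnj a * b)"

text \<open>
  A crossing is positive if the tangent of the over-strand followed by the tangent of the
  under-strand is a positively oriented basis of the plane, and negative if it is a negatively
  oriented one. (A non-transverse crossing would have sign \<open>0\<close>; there is none in a diagram.)
\<close>

definition crossing_sign :: "link \<Rightarrow> real \<times> real \<Rightarrow> real" where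
  "crossing_sign K = (\<lambda>(s, t).
     if snd (fst K s) > snd (snd K t)
     then sgn (planar_det (planar_tangent (fst K) s) (planar_tangent (snd K) t))
     else sgn (planar_det (planar_tangent (snd K) t) (planar_tangent (fst K) s)))"

definition linking_number :: "link \<Rightarrow> real" where
  "linking_number K =
     real (card {c \<in> crossings K. crossing_sign K c = 1}) / 2
     - real (card {c \<in> crossings K. crossing_sign K c = -1}) / 2"


subsection \<open>Petal diagrams\<close>

text \<open>
  A component with \<open>2m\<close> straight arcs is a cyclic sequence of \<open>4m\<close> pieces, namely arc \<open>1\<close>,
  petal \<open>1\<close>, arc \<open>2\<close>, petal \<open>2\<close>, and so on, in the order of travel. The \<open>4m\<close> pieces
  are traversed in parameter intervals of equal length. The indices \<open>i\<close> run over \<open>1, ..., 2m\<close>.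
\<close>

definition straight_part ::
    "nat \<Rightarrow> nat \<Rightarrow> (real \<Rightarrow> 'a::real_normed_vector) \<Rightarrow> real \<Rightarrow> 'a" where
  "straight_part m i g =
     subpath ((2 * real i - 2) / (4 * real m)) ((2 * real i - 1) / (4 * real m)) g"

definition petal_part ::
    "nat \<Rightarrow> nat \<Rightarrow> (real \<Rightarrow> 'a::real_normed_vector) \<Rightarrow> real \<Rightarrow> 'a" where
  "petal_part m i g = subpath ((2 * real i - 1) / (4 * real m)) (2 * real i / (4 * real m)) g"

definition sector :: "real \<Rightarrow> real \<Rightarrow> complex set" where
  "sector a b = {rcis r \<theta> | r \<theta>. 0 \<le> r \<and> \<theta> \<in> closed_segment a b}"

definition petal :: "real \<Rightarrow> real \<Rightarrow> planar_curve \<Rightarrow> bool" where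
  "petal a b p \<longleftrightarrow>
     arc p \<and> pathstart p = cis a \<and> pathfinish p = cis b \<and>
     (\<forall>u\<in>{0<..<1}. norm (p u) > 1) \<and> path_image p \<subseteq> sector a b"

text \<open>
  The straight arc number \<open>i\<close> is the diameter at angle \<open>\<alpha> (2m + 1 - i)\<close>. After it, if \<open>i\<close> is odd,
  comes the petal between the angles \<open>\<alpha> (2j) + pi\<close> and \<open>\<alpha> (2j - 1) + pi\<close> where \<open>i = 2m + 1 - 2j\<close>;
  if \<open>i < 2m\<close> is even, the petal between \<open>\<alpha> (2j + 1)\<close> and \<open>\<alpha> (2j)\<close> where \<open>i = 2m - 2j\<close>; and
  for \<open>i = 2m\<close> the outer petal. That the outer petal encompasses the inner ones at the angles
  \<open>\<alpha> 2, ..., \<alpha> (2m - 1)\<close> follows from disjointness and from the sector conditions.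
\<close>

definition petal_component :: "nat \<Rightarrow> (nat \<Rightarrow> real) \<Rightarrow> planar_curve \<Rightarrow> bool" where
  "petal_component m \<alpha> g \<longleftrightarrow>
     closed_curve g \<and>
     (\<forall>i\<in>{1..2*m}. \<forall>u\<in>{0..1}. straight_part m i g u =
        (let \<theta> = \<alpha> (2*m + 1 - i) in
           if odd i then linepath (cis \<theta>) (cis (\<theta> + pi)) u
           else linepath (cis (\<theta> + pi)) (cis \<theta>) u)) \<and>
     (\<forall>j\<in>{1..m}. petal (\<alpha> (2*j) + pi) (\<alpha> (2*j - 1) + pi) (petal_part m (2*m + 1 - 2*j) g)) \<and>
     (\<forall>j\<in>{1..m-1}. petal (\<alpha> (2*j + 1)) (\<alpha> (2*j)) (petal_part m (2*m - 2*j) g)) \<and>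
     petal (\<alpha> 1) (\<alpha> (2*m)) (petal_part m (2*m) g) \<and>
     (\<forall>i\<in>{1..2*m}. \<forall>j\<in>{1..2*m}. i \<noteq> j \<longrightarrow>
        path_image (petal_part m i g) \<inter> path_image (petal_part m j g) = {})"

text \<open>
  Petals of different components are automatically disjoint, as they lie in different quadrants.
\<close>

definition petal_diagram ::
    "nat \<Rightarrow> nat \<Rightarrow> (nat \<Rightarrow> real) \<Rightarrow> (nat \<Rightarrow> real) \<Rightarrow> planar_diagram \<Rightarrow> bool" where
  "petal_diagram m n \<alpha> \<beta> D \<longleftrightarrow>
     strict_mono_on {1..2*m} \<alpha> \<and> 0 < \<alpha> 1 \<and> \<alpha> (2*m) < pi/2 \<and>
     strict_mono_on {1..2*n} \<beta> \<and> pi/2 < \<beta> 1 \<and> \<beta> (2*n) < pi \<and>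
     petal_component m \<alpha> (fst D) \<and> petal_component n \<beta> (snd D)"


subsection \<open>Petal links\<close>

definition lifts :: "planar_curve \<Rightarrow> space_curve \<Rightarrow> bool" where
  "lifts g k \<longleftrightarrow> closed_curve k \<and> (\<forall>t\<in>{0..1}. fst (k t) = g t)"

text \<open>
  \<open>petal_link m n D \<sigma> K\<close> says that \<open>K\<close> represents the link $L_{2m,2n}(\sigma)$. The heights along the
  petals are arbitrary.
\<close>

definition petal_link ::
    "nat \<Rightarrow> nat \<Rightarrow> planar_diagram \<Rightarrow> (nat \<Rightarrow> nat) \<Rightarrow> link \<Rightarrow> bool" where
  "petal_link m n D \<sigma> K \<longleftrightarrow>
     lifts (fst D) (fst K) \<and> lifts (snd D) (snd K) \<and>
     (\<forall>i\<in>{1..2*m}. \<forall>u\<in>{0..1}. snd (straight_part m i (fst K) u) = real (\<sigma> i)) \<and>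
     (\<forall>i\<in>{1..2*n}. \<forall>u\<in>{0..1}. snd (straight_part n i (snd K) u) = real (\<sigma> (2*m + i)))"

definition random_petal_link :: "nat \<Rightarrow> nat \<Rightarrow> ((nat \<Rightarrow> nat) \<Rightarrow> link) \<Rightarrow> link pmf" where
  "random_petal_link m n L = map_pmf L (pmf_of_set {\<sigma>. \<sigma> permutes {1..2*m + 2*n}})"

end

theory Submission
  imports Defs
begin

text \<open>
  All crossings between the two components sit at the origin, which turns the linking number into
  the signed sum over pairs of arcs. Group the heights into pairs $\{2k-1, 2k\}$. Exchanging the two
  arcs at heights $2k-1$ and $2k$ changes the linking number by $\pm 1$ if they belong to different
  components, and not at all otherwise. Averaging over all $2^{m+n}$ choices of exchanges, the
  linking number therefore behaves, given the contents of the pairs, like a subset sum with steps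
  $\pm 1$, whose most likely value is no more likely than a balanced choice, i.e. than the event that
  exactly half of the arcs of the first component lie at odd heights. That event has probability
  $\binom{m+n}{m}^2 / \binom{2m+2n}{2m} = \binom{2m}{m} \binom{2n}{n} / \binom{2m+2n}{m+n}$, which
  the estimates $4^k / (2 \sqrt k) \le \binom{2k}{k} \le 4^k / \sqrt{2k+1}$ bound by
  $\sqrt{1/m + 1/n}$.
\<close>

section \<open>The linking number of a petal link\<close>

text \<open>The midpoint of the parameter interval [(2i-2)/(4m), (2i-1)/(4m)] of arc
  \<open>i\<close>, hence the moment at which this diameter passes through the origin.\<close>

definition arc_mid :: "nat \<Rightarrow> nat \<Rightarrow> real" where
  "arc_mid m i = (4 * real i - 3) / (8 * real m)"

lemma inj_arc_mid: "m > 0 \<Longrightarrow> inj (arc_mid m)"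
  by (auto simp: inj_def arc_mid_def)

lemma arc_mid_in_range:
  assumes "m > 0" "i \<in> {1..2*m}"
  shows "arc_mid m i \<in> {0..<1}"
proof -
  have "1 \<le> real i" "real i \<le> 2 * real m" using assms(2) by auto
  then show ?thesis using assms(1) by (simp add: arc_mid_def field_simps)
qed

lemma straight_part_half: "m > 0 \<Longrightarrow> straight_part m i g (1/2) = g (arc_mid m i)"
  by (simp add: straight_part_def subpath_def arc_mid_def field_simps)

text \<open>On an arc the global parameter is kept, because an affine formula in \<open>s\<close> is
  used there. On a petal only the position of the point matters, so \<open>g s\<close> is expressed
  through the local parameter \<open>u\<close>.\<close>

lemma straight_or_petal_part:
  assumes "m > 0" "s \<in> {0..1}"
  obtains i where "i \<in> {1..2*m}" "s \<in> {(2 * real i - 2) / (4 * real m)..(2 * real i - 1) / (4 * real m)}"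
  | i u where "i \<in> {1..2*m}" "u \<in> {0..1}" "g s = petal_part m i g u"
proof -
  define x where "x = 4 * real m * s"
  \<comment> \<open>The cap assigns the endpoint \<open>s = 1\<close>, where the floor of
    \<open>x\<close> is 4m, to the last petal.\<close>
  define k where "k = min (nat \<lfloor>x\<rfloor>) (4 * m - 1)"
  have x: "0 \<le> x" "x \<le> real (4 * m)" using assms by (auto simp: x_def)
  have s: "s = x / (4 * real m)" using assms(1) by (simp add: x_def)
  have k: "real k \<le> x" "x \<le> real k + 1" "k < 4 * m"
    using x assms(1) by (auto simp: k_def min_def of_nat_diff, linarith+)
  show thesis
  proof (cases "even k")
    case True
    then obtain l where l: "k = 2 * l" by (elim evenE)
    have "l + 1 \<in> {1..2*m}" using k(3) l by simp
    moreover have "s \<in> {(2 * real (l + 1) - 2) / (4 * real m)..(2 * real (l + 1) - 1) / (4 * real m)}"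
      unfolding s using k(1,2) l assms(1) by (simp add: field_simps)
    ultimately show thesis by (rule that(1))
  next
    case False
    then obtain l where l: "k = 2 * l + 1" by (elim oddE)
    have "l + 1 \<in> {1..2*m}" using k(3) l by simp
    moreover have "x - real k \<in> {0..1}" using k by simp
    moreover have "(2 * real (l + 1) / (4 * real m) - (2 * real (l + 1) - 1) / (4 * real m)) * (x - real k)
        + (2 * real (l + 1) - 1) / (4 * real m) = s"
      using assms(1) by (simp add: s l field_simps)
    then have "g s = petal_part m (l + 1) g (x - real k)"
      by (simp only: petal_part_def subpath_def)
    ultimately show thesis by (rule that(2))
  qed
qed

lemma strict_mono_on_in_range:
  fixes \<alpha> :: "nat \<Rightarrow> real"
  assumes "strict_mono_on {1..2*m} \<alpha>" "i \<in> {1..2*m}"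
  shows "\<alpha> i \<in> {\<alpha> 1..\<alpha> (2*m)}"
  using assms(2) strict_mono_on_leD[OF assms(1), of 1 i] strict_mono_on_leD[OF assms(1), of i "2*m"]
  by auto

text \<open>The far endpoint is - cis \<theta>, so in the local parameter an odd arc is (1 - 2u) cis
  \<theta> and an even one is (2u - 1) cis \<theta>. One affine function of the global parameter
  covers both and shows the zero and the velocity.\<close>

lemma petal_component_straight:
  assumes "petal_component m \<alpha> g" "m > 0" "i \<in> {1..2*m}"
    and s: "s \<in> {(2 * real i - 2) / (4 * real m)..(2 * real i - 1) / (4 * real m)}"
  shows "g s = of_real ((-1) ^ i * (8 * real m * s - (4 * real i - 3))) * cis (\<alpha> (2*m + 1 - i))"
proof -
  define u where "u = 4 * real m * s - (2 * real i - 2)"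
  define \<theta> where "\<theta> = \<alpha> (2*m + 1 - i)"
  have u: "u \<in> {0..1}" using s assms(2) by (auto simp: u_def field_simps)
  have "g s = straight_part m i g u"
    using assms(2) by (simp add: straight_part_def subpath_def u_def field_simps)
  also have "\<dots> = (if odd i then linepath (cis \<theta>) (cis (\<theta> + pi)) u
      else linepath (cis (\<theta> + pi)) (cis \<theta>) u)"
    using assms(1,3) u unfolding petal_component_def Let_def \<theta>_def by blast
  also have "\<dots> = of_real ((-1) ^ i * (2 * u - 1)) * cis \<theta>"
  proof -
    have "cis (\<theta> + pi) = - cis \<theta>" by (simp add: cis_mult[symmetric])
    then show ?thesis by (simp add: linepath_def scaleR_conv_of_real algebra_simps)
  qed
  finally show ?thesis by (simp add: \<theta>_def u_def algebra_simps)
qed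

text \<open>Forgets which petal it is: later only its confinement to the double cone of lines
  between the extreme angles matters, on one side of the origin or on the other.\<close>

lemma petal_component_petal:
  assumes "petal_component m \<alpha> g" "m > 0" "strict_mono_on {1..2*m} \<alpha>" "i \<in> {1..2*m}"
  obtains a b where "petal a b (petal_part m i g)"
    "closed_segment a b \<subseteq> {\<alpha> 1..\<alpha> (2*m)} \<or> closed_segment a b \<subseteq> {\<alpha> 1 + pi..\<alpha> (2*m) + pi}"
proof -
  have le: "\<alpha> 1 \<le> \<alpha> j \<and> \<alpha> j \<le> \<alpha> (2*m)" if "1 \<le> j" "j \<le> 2*m" for j
    using strict_mono_on_in_range[OF assms(3), of j] that by auto
  have seg: "closed_segment a b \<subseteq> {c..d}" if "a \<in> {c..d}" "b \<in> {c..d}" for a b c d :: real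
    using that by (auto simp: closed_segment_eq_real_ivl split: if_splits)
  consider "odd i" | "even i" "i < 2*m" | "i = 2*m" using assms(4) by fastforce
  then show thesis
  proof cases
    case 1
    then obtain k where k: "i = 2 * k + 1" by (elim oddE)
    \<comment> \<open>The petals are numbered against the order of travel, so \<open>j\<close>
      counts from the far end.\<close>
    define j where "j = m - k"
    have j: "j \<in> {1..m}" "i = 2*m + 1 - 2*j" using k assms(4) by (auto simp: j_def)
    then have "petal (\<alpha> (2*j) + pi) (\<alpha> (2*j - 1) + pi) (petal_part m i g)"
      using assms(1) by (simp add: petal_component_def)
    moreover have "closed_segment (\<alpha> (2*j) + pi) (\<alpha> (2*j - 1) + pi) \<subseteq> {\<alpha> 1 + pi..\<alpha> (2*m) + pi}"
      using le[of "2*j"] le[of "2*j - 1"] j(1) by (intro seg) (auto simp: numeral_2_eq_2)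
    ultimately show thesis using that by blast
  next
    case 2
    then obtain k where k: "i = 2 * k" by (elim evenE)
    define j where "j = m - k"
    have j: "j \<in> {1..m-1}" "i = 2*m - 2*j" using k assms(4) 2 by (auto simp: j_def)
    then have "petal (\<alpha> (2*j + 1)) (\<alpha> (2*j)) (petal_part m i g)"
      using assms(1) by (simp add: petal_component_def)
    moreover have "closed_segment (\<alpha> (2*j + 1)) (\<alpha> (2*j)) \<subseteq> {\<alpha> 1..\<alpha> (2*m)}"
      using le[of "2*j"] le[of "2*j + 1"] j(1) by (intro seg) auto
    ultimately show thesis using that by blast
  next
    case 3
    then have "petal (\<alpha> 1) (\<alpha> (2*m)) (petal_part m i g)"
      using assms(1) by (simp add: petal_component_def)
    moreover have "closed_segment (\<alpha> 1) (\<alpha> (2*m)) \<subseteq> {\<alpha> 1..\<alpha> (2*m)}"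
      using le[of 1] le[of "2*m"] assms(2) by (intro seg) auto
    ultimately show thesis using that by blast
  qed
qed

lemma petal_nonzero:
  assumes "petal a b p" "u \<in> {0..1}"
  shows "p u \<noteq> 0"
proof -
  have "p 0 = cis a" "p 1 = cis b" "\<forall>u\<in>{0<..<1}. norm (p u) > 1"
    using assms(1) by (auto simp: petal_def pathstart_def pathfinish_def)
  moreover have "u = 0 \<or> u = 1 \<or> u \<in> {0<..<1}" using assms(2) by auto
  ultimately show ?thesis by (metis cis_neq_zero norm_zero not_one_less_zero)
qed

text \<open>Both claims come from one run through the pieces. The radius \<open>r\<close> may be
  negative, so opposite sectors share one range of angles. Petals avoid the origin, which leaves
  only the midpoints of arcs as zeros.\<close>

lemma
  assumes "petal_component m \<alpha> g" "m > 0" "strict_mono_on {1..2*m} \<alpha>" "s \<in> {0..1}"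
  shows petal_component_eq_rcis: "\<exists>r \<theta>. g s = rcis r \<theta> \<and> \<theta> \<in> {\<alpha> 1..\<alpha> (2*m)}"
    and petal_component_eq_0: "g s = 0 \<Longrightarrow> \<exists>i\<in>{1..2*m}. s = arc_mid m i"
proof -
  have "(\<exists>r \<theta>. g s = rcis r \<theta> \<and> \<theta> \<in> {\<alpha> 1..\<alpha> (2*m)}) \<and> (g s = 0 \<longrightarrow> (\<exists>i\<in>{1..2*m}. s = arc_mid m i))"
    using assms(2,4)
  proof (cases rule: straight_or_petal_part[where g = g])
    case (1 i)
    have "\<alpha> (2*m + 1 - i) \<in> {\<alpha> 1..\<alpha> (2*m)}"
      using 1(1) by (intro strict_mono_on_in_range[OF assms(3)]) auto
    moreover have eq: "g s = rcis ((-1) ^ i * (8 * real m * s - (4 * real i - 3))) (\<alpha> (2*m + 1 - i))"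
      using petal_component_straight[OF assms(1,2) 1] by (simp add: rcis_def)
    moreover have "s = arc_mid m i" if "g s = 0"
    proof -
      have "8 * real m * s = 4 * real i - 3" using that unfolding eq by simp
      then show ?thesis using assms(2) by (simp add: arc_mid_def field_simps)
    qed
    ultimately show ?thesis using 1(1) by blast
  next
    case (2 i u)
    obtain a b where ab: "petal a b (petal_part m i g)"
      "closed_segment a b \<subseteq> {\<alpha> 1..\<alpha> (2*m)} \<or> closed_segment a b \<subseteq> {\<alpha> 1 + pi..\<alpha> (2*m) + pi}"
      using petal_component_petal[OF assms(1-3) 2(1)] .
    have "g s \<noteq> 0" using petal_nonzero[OF ab(1) 2(2)] 2(3) by simp
    moreover have "g s \<in> sector a b"
      using ab(1) 2(2,3) by (auto simp: petal_def path_image_def)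
    then obtain r \<theta> where r\<theta>: "g s = rcis r \<theta>" "\<theta> \<in> closed_segment a b"
      by (auto simp: sector_def)
    moreover have "rcis r \<theta> = rcis (- r) (\<theta> - pi)" by (simp add: complex_eq_iff)
    moreover from r\<theta>(2) ab(2) have "\<theta> \<in> {\<alpha> 1..\<alpha> (2*m)} \<or> \<theta> - pi \<in> {\<alpha> 1..\<alpha> (2*m)}" by force
    ultimately show ?thesis by metis
  qed
  then show "\<exists>r \<theta>. g s = rcis r \<theta> \<and> \<theta> \<in> {\<alpha> 1..\<alpha> (2*m)}"
    "g s = 0 \<Longrightarrow> \<exists>i\<in>{1..2*m}. s = arc_mid m i" by blast+
qed

lemma petal_component_arc_mid:
  assumes "petal_component m \<alpha> g" "m > 0" "i \<in> {1..2*m}"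
  shows "g (arc_mid m i) = 0"
  using assms by (subst petal_component_straight[OF assms]) (auto simp: arc_mid_def field_simps)

text \<open>The product of the two coordinates is r^2 cos \<theta> sin \<theta>. Away from the
  origin it is positive on lines through the first and third quadrants and negative on lines through
  the other two.\<close>

lemma rcis_eq_rcis_quadrants:
  assumes "rcis r \<theta> = rcis r' \<theta>'" "0 < \<theta>" "\<theta> < pi/2" "pi/2 < \<theta>'" "\<theta>' < pi"
  shows "rcis r \<theta> = 0"
proof (rule ccontr)
  assume "rcis r \<theta> \<noteq> 0"
  then have "r \<noteq> 0" "r' \<noteq> 0" using assms(1) by auto
  have "cos \<theta> > 0" "sin \<theta> > 0" "sin \<theta>' > 0"
    using assms(2-5) by (auto intro!: cos_gt_zero sin_gt_zero)
  moreover have "cos \<theta>' < 0"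
    using cos_monotone_0_pi[of "pi/2" \<theta>'] assms(4,5) by simp
  ultimately have "r\<^sup>2 * (cos \<theta> * sin \<theta>) > 0" "r'\<^sup>2 * (cos \<theta>' * sin \<theta>') < 0"
    using \<open>r \<noteq> 0\<close> \<open>r' \<noteq> 0\<close> by (simp_all add: zero_less_mult_iff mult_less_0_iff)
  moreover have "r * cos \<theta> = r' * cos \<theta>'" "r * sin \<theta> = r' * sin \<theta>'"
    using assms(1) by (auto simp: complex_eq_iff)
  then have "r\<^sup>2 * (cos \<theta> * sin \<theta>) = r'\<^sup>2 * (cos \<theta>' * sin \<theta>')"
    by (metis (no_types, opaque_lifting) mult.assoc mult.left_commute power2_eq_square)
  ultimately show False by linarith
qed

lemma planar_tangent_arc_mid:
  assumes "petal_component m \<alpha> g" "m > 0" "i \<in> {1..2*m}" "lifts g k"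
  shows "planar_tangent k (arc_mid m i) = of_real ((-1) ^ i * (8 * real m)) * cis (\<alpha> (2*m + 1 - i))"
proof -
  \<comment> \<open>The derivative at the midpoint depends only on this open interval, which lies
    inside the unit interval, where \<open>lifts\<close> fixes the projection.\<close>
  define I where "I = {(2 * real i - 2) / (4 * real m)<..<(2 * real i - 1) / (4 * real m)}"
  define c where "c = cis (\<alpha> (2*m + 1 - i))"
  have "((\<lambda>s. of_real ((-1) ^ i * (8 * real m * s - (4 * real i - 3))) * c)
      has_vector_derivative of_real ((-1) ^ i * (8 * real m)) * c) (at (arc_mid m i))"
    unfolding has_vector_derivative_def
    by (auto intro!: derivative_eq_intros simp: scaleR_conv_of_real algebra_simps)
  then have "((fst \<circ> k) has_vector_derivative of_real ((-1) ^ i * (8 * real m)) * c) (at (arc_mid m i))"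
  proof (rule has_vector_derivative_transform_within_open)
    show "open I" by (simp add: I_def)
    show "arc_mid m i \<in> I" using assms(2) by (auto simp: I_def arc_mid_def field_simps)
    fix s assume s: "s \<in> I"
    have "0 \<le> (2 * real i - 2) / (4 * real m)" "(2 * real i - 1) / (4 * real m) \<le> 1"
      using assms(2,3) by (auto simp: field_simps)
    then have "s \<in> {0..1}" using s by (auto simp: I_def)
    then have "fst (k s) = g s" using assms(4) by (auto simp: lifts_def)
    then show "of_real ((-1) ^ i * (8 * real m * s - (4 * real i - 3))) * c = (fst \<circ> k) s"
      using petal_component_straight[OF assms(1-3), of s] s by (simp add: I_def c_def)
  qed
  then show ?thesis unfolding planar_tangent_def c_def by (rule vector_derivative_at)
qed

text \<open>The components occupy different quadrants and meet only at the origin, where each arc of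
  one crosses each arc of the other once. The angle from the first arc to the second lies between 0
  and pi, so the sign is determined by the two directions of travel and the order of the
  heights.\<close>

lemma linking_number_petal_link:
  assumes "m > 0" "n > 0" "petal_diagram m n \<alpha> \<beta> D" "petal_link m n D \<sigma> K" "inj \<sigma>"
  shows "linking_number K
    = (\<Sum>i\<in>{1..2*m}. \<Sum>j\<in>{1..2*n}. (-1) ^ (i + j) * sgn (real (\<sigma> i) - real (\<sigma> (2*m + j)))) / 2"
proof -
  have \<alpha>: "strict_mono_on {1..2*m} \<alpha>" "0 < \<alpha> 1" "\<alpha> (2*m) < pi/2" "petal_component m \<alpha> (fst D)"
    and \<beta>: "strict_mono_on {1..2*n} \<beta>" "pi/2 < \<beta> 1" "\<beta> (2*n) < pi" "petal_component n \<beta> (snd D)"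
    using assms(3) by (auto simp: petal_diagram_def)
  have lifts: "lifts (fst D) (fst K)" "lifts (snd D) (snd K)"
    using assms(4) by (auto simp: petal_link_def)
  have neq: "\<sigma> i \<noteq> \<sigma> (2*m + j)" if "i \<in> {1..2*m}" "j \<in> {1..2*n}" for i j
    using that by (auto simp: inj_eq[OF assms(5)])
  define c where "c = (\<lambda>(i, j). (arc_mid m i, arc_mid n j))"
  define S where "S = {1..2*m} \<times> {1..2*n}"
  have inj: "inj_on c S"
    using inj_arc_mid[OF assms(1)] inj_arc_mid[OF assms(2)] by (auto simp: inj_on_def c_def dest: injD)
  have crossings: "crossings K = c ` S"
  proof (intro subset_antisym subsetI)
    fix p assume "p \<in> crossings K"
    then obtain s t where p: "p = (s, t)" and st: "s \<in> {0..<1}" "t \<in> {0..<1}"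
      and eq: "fst D s = snd D t"
      using lifts by (auto simp: crossings_def lifts_def)
    have st': "s \<in> {0..1}" "t \<in> {0..1}" using st by auto
    obtain r \<theta> where r: "fst D s = rcis r \<theta>" "\<theta> \<in> {\<alpha> 1..\<alpha> (2*m)}"
      using petal_component_eq_rcis[OF \<alpha>(4) assms(1) \<alpha>(1) st'(1)] by blast
    obtain r' \<theta>' where r': "snd D t = rcis r' \<theta>'" "\<theta>' \<in> {\<beta> 1..\<beta> (2*n)}"
      using petal_component_eq_rcis[OF \<beta>(4) assms(2) \<beta>(1) st'(2)] by blast
    have "fst D s = 0"
      using rcis_eq_rcis_quadrants[of r \<theta> r' \<theta>'] eq r r' \<alpha>(2,3) \<beta>(2,3) by auto
    then show "p \<in> c ` S"
      using petal_component_eq_0[OF \<alpha>(4) assms(1) \<alpha>(1) st'(1)]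
        petal_component_eq_0[OF \<beta>(4) assms(2) \<beta>(1) st'(2)] eq
      by (force simp: p c_def S_def)
  next
    fix p assume "p \<in> c ` S"
    then obtain i j where p: "p = (arc_mid m i, arc_mid n j)" and ij: "i \<in> {1..2*m}" "j \<in> {1..2*n}"
      by (auto simp: c_def S_def)
    have "arc_mid m i \<in> {0..<1}" "arc_mid n j \<in> {0..<1}"
      using arc_mid_in_range ij assms(1,2) by blast+
    moreover have "fst D (arc_mid m i) = 0" "snd D (arc_mid n j) = 0"
      using petal_component_arc_mid \<alpha>(4) \<beta>(4) assms(1,2) ij by blast+
    ultimately show "p \<in> crossings K"
      using lifts by (simp add: p crossings_def lifts_def)
  qed
  have sign: "crossing_sign K (c (i, j)) = (-1) ^ (i + j) * sgn (real (\<sigma> i) - real (\<sigma> (2*m + j)))"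
    if ij: "i \<in> {1..2*m}" "j \<in> {1..2*n}" for i j
  proof -
    define a where "a = \<alpha> (2*m + 1 - i)"
    define b where "b = \<beta> (2*n + 1 - j)"
    have "a \<in> {\<alpha> 1..\<alpha> (2*m)}"
      unfolding a_def using ij(1) by (intro strict_mono_on_in_range[OF \<alpha>(1)]) auto
    moreover have "b \<in> {\<beta> 1..\<beta> (2*n)}"
      unfolding b_def using ij(2) by (intro strict_mono_on_in_range[OF \<beta>(1)]) auto
    ultimately have "sin (b - a) > 0"
      using \<alpha>(2,3) \<beta>(2,3) by (intro sin_gt_zero) auto
    then have sgn_sin: "sgn (sin (b - a)) = 1" by simp
    have det: "planar_det (of_real x * cis a) (of_real y * cis b) = x * y * sin (b - a)"
      "planar_det (of_real y * cis b) (of_real x * cis a) = - (x * y * sin (b - a))" for x y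
      by (simp_all add: planar_det_def sin_diff algebra_simps)
    have tangents: "planar_tangent (fst K) (arc_mid m i) = of_real ((-1) ^ i * (8 * real m)) * cis a"
      "planar_tangent (snd K) (arc_mid n j) = of_real ((-1) ^ j * (8 * real n)) * cis b"
      unfolding a_def b_def using planar_tangent_arc_mid \<alpha>(4) \<beta>(4) assms(1,2) ij lifts by blast+
    have heights: "snd (fst K (arc_mid m i)) = real (\<sigma> i)" "snd (snd K (arc_mid n j)) = real (\<sigma> (2*m + j))"
    proof -
      have "snd (straight_part m i (fst K) (1/2)) = real (\<sigma> i)"
        "snd (straight_part n j (snd K) (1/2)) = real (\<sigma> (2*m + j))"
        using assms(4) ij unfolding petal_link_def by auto
      then show "snd (fst K (arc_mid m i)) = real (\<sigma> i)" "snd (snd K (arc_mid n j)) = real (\<sigma> (2*m + j))"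
        using assms(1,2) by (simp_all add: straight_part_half)
    qed
    have sgn_power: "sgn ((-1) ^ k :: real) = (-1) ^ k" for k :: nat
      by (simp add: minus_one_power_iff)
    show ?thesis
      unfolding c_def crossing_sign_def prod.case tangents heights det
      using neq[OF ij] assms(1,2) by (simp add: sgn_mult sgn_sin sgn_power power_add)
  qed
  have pm: "crossing_sign K p \<in> {1, -1}" if p_in: "p \<in> crossings K" for p
  proof -
    obtain i j where p: "p = c (i, j)" "i \<in> {1..2*m}" "j \<in> {1..2*n}"
      using p_in unfolding crossings S_def by blast
    show ?thesis
      unfolding p(1) sign[OF p(2,3)] using neq[OF p(2,3)] by (simp add: sgn_if minus_one_power_iff)
  qed
  have fin: "finite (crossings K)" by (simp add: crossings S_def)
  \<comment> \<open>As every sign is 1 or -1, the difference of the two counts in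
    \<open>linking_number\<close> is the plain sum of the signs.\<close>
  have "(\<Sum>p\<in>crossings K. crossing_sign K p)
    = (\<Sum>p\<in>crossings K. (if crossing_sign K p = 1 then 1 else 0) - (if crossing_sign K p = -1 then 1 else 0))"
    using pm by (intro sum.cong) auto
  also have "\<dots> = real (card {p \<in> crossings K. crossing_sign K p = 1})
      - real (card {p \<in> crossings K. crossing_sign K p = -1})"
    using fin by (simp add: sum_subtractf sum.If_cases Int_def)
  finally have "linking_number K = (\<Sum>p\<in>crossings K. crossing_sign K p) / 2"
    by (simp add: linking_number_def diff_divide_distrib)
  also have "(\<Sum>p\<in>crossings K. crossing_sign K p) = (\<Sum>q\<in>S. crossing_sign K (c q))"
    unfolding crossings by (simp add: sum.reindex[OF inj])
  also have "\<dots> = (\<Sum>(i, j)\<in>S. (-1) ^ (i + j) * sgn (real (\<sigma> i) - real (\<sigma> (2*m + j))))"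
    using sign by (intro sum.cong) (auto simp: S_def)
  finally show ?thesis by (simp add: S_def sum.cartesian_product)
qed

section \<open>Subset sums with steps $\pm 1$\<close>

text \<open>The parts \<open>S \<inter> P\<close> and \<open>S - P\<close> can be chosen
  independently.\<close>

lemma card_Pow_card_Int:
  assumes "finite Q" "P \<subseteq> Q"
  shows "card {S \<in> Pow Q. card (S \<inter> P) = r} = 2 ^ card (Q - P) * (card P choose r)"
proof -
  have "bij_betw (\<lambda>S. (S \<inter> P, S - P)) {S \<in> Pow Q. card (S \<inter> P) = r}
          ({X. X \<subseteq> P \<and> card X = r} \<times> Pow (Q - P))"
    using assms(2)
    by (intro bij_betw_byWitness[where f' = "\<lambda>(X, Y). X \<union> Y"])
       (auto simp: Un_Int_distrib2 Int_absorb2 inf_absorb1 intro!: arg_cong[where f = card])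
  then have "card {S \<in> Pow Q. card (S \<inter> P) = r} = card ({X. X \<subseteq> P \<and> card X = r} \<times> Pow (Q - P))"
    by (rule bij_betw_same_card)
  then show ?thesis
    using assms finite_subset[OF assms(2,1)] by (simp add: card_cartesian_product n_subsets card_Pow)
qed

text \<open>Combined with \<open>card_Pow_card_Int\<close>, this makes the number of subsets with a
  given sum a power of two times one binomial coefficient of \<open>card P\<close>. Negative steps
  merely shift the sum.\<close>

lemma card_subset_sum_eq:
  fixes d :: "'a \<Rightarrow> int"
  assumes "finite Q" "\<And>k. k \<in> Q \<Longrightarrow> \<bar>d k\<bar> \<le> 1"
  defines "P \<equiv> {k \<in> Q. d k \<noteq> 0}" and "N \<equiv> {k \<in> Q. d k < 0}"
  shows "card {S \<in> Pow Q. sum d S = c} =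
           card {S \<in> Pow Q. int (card (S \<inter> P)) = c + int (card N)}"
proof -
  \<comment> \<open>Taking the symmetric difference with \<open>N\<close> turns the signed sum into a cardinality.\<close>
  define f where "f = (\<lambda>S. (S - N) \<union> (N - S))"
  have sum_eq: "sum d S = int (card (f S \<inter> P)) - int (card N)" if "S \<subseteq> Q" for S
  proof -
    have fin: "finite S" "finite N" "finite P"
      using that assms(1) finite_subset by (auto simp: N_def P_def)
    have "f S \<inter> P = (S \<inter> P - N) \<union> (N - S)"
      by (auto simp: f_def P_def N_def)
    then have "card (f S \<inter> P) = card (S \<inter> P - N) + card (N - S)"
      using fin by (simp only:) (subst card_Un_disjoint, auto)
    moreover have "card N = card (N - S) + card (S \<inter> N)"
      using fin by (subst card_Un_disjoint[symmetric]) (auto intro!: arg_cong[where f = card])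
    moreover have "sum d S = sum d (S \<inter> P - N) + sum d (S \<inter> N)"
      using fin that by (subst sum.union_disjoint[symmetric])
        (auto simp: P_def N_def intro!: sum.mono_neutral_right)
    moreover have "sum d (S \<inter> P - N) = (\<Sum>k\<in>S \<inter> P - N. 1)"
      using assms(2) by (intro sum.cong) (force simp: P_def N_def)+
    moreover have "sum d (S \<inter> N) = (\<Sum>k\<in>S \<inter> N. - 1)"
      using assms(2) by (intro sum.cong) (force simp: P_def N_def)+
    ultimately show ?thesis by simp
  qed
  have "bij_betw f {S \<in> Pow Q. sum d S = c}
          {S \<in> Pow Q. int (card (S \<inter> P)) = c + int (card N)}"
  proof (rule bij_betw_byWitness[where f' = f])
    have ff: "f (f S) = S" for S by (auto simp: f_def)
    have fQ: "f S \<subseteq> Q" if "S \<subseteq> Q" for S using that by (auto simp: f_def N_def)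
    show "\<forall>S\<in>{S \<in> Pow Q. sum d S = c}. f (f S) = S"
      "\<forall>S\<in>{S \<in> Pow Q. int (card (S \<inter> P)) = c + int (card N)}. f (f S) = S"
      using ff by auto
    show "f ` {S \<in> Pow Q. sum d S = c} \<subseteq> {S \<in> Pow Q. int (card (S \<inter> P)) = c + int (card N)}"
      using fQ by (auto simp: sum_eq)
    show "f ` {S \<in> Pow Q. int (card (S \<inter> P)) = c + int (card N)} \<subseteq> {S \<in> Pow Q. sum d S = c}"
      using fQ by (auto simp: sum_eq ff)
  qed
  then show ?thesis by (rule bij_betw_same_card)
qed

text \<open>Both functions have the same set \<open>P\<close> of nonzero steps, so both counts are
  the same power of two times a binomial coefficient of \<open>card P\<close>, or the left one is
  zero. The balanced condition selects the central, largest coefficient; evenness of the total makes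
  \<open>card P\<close> even, so that the centre is attained.\<close>

lemma card_subset_sum_le_balanced:
  fixes d D :: "'a \<Rightarrow> int"
  assumes "finite Q" "\<And>k. k \<in> Q \<Longrightarrow> \<bar>D k\<bar> \<le> 1" "\<And>k. k \<in> Q \<Longrightarrow> \<bar>d k\<bar> = \<bar>D k\<bar>"
    and "even (sum D Q)"
  shows "card {S \<in> Pow Q. sum d S = c} \<le> card {S \<in> Pow Q. 2 * sum D S = sum D Q}"
proof -
  define P where "P = {k \<in> Q. D k \<noteq> 0}"
  define N where "N = {k \<in> Q. D k < 0}"
  have P': "{k \<in> Q. d k \<noteq> 0} = P" unfolding P_def using assms(3) by (metis abs_0_eq abs_eq_0)
  have PQ: "P \<subseteq> Q" "finite P" "finite N" using assms(1) by (auto simp: P_def N_def)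
  have "card P = card (P - N) + card N"
    using PQ by (subst card_Un_disjoint[symmetric])
      (auto simp: P_def N_def intro!: arg_cong[where f = card])
  moreover have "sum D Q = sum D (P - N) + sum D N"
    using assms(1) by (subst sum.union_disjoint[symmetric])
      (auto simp: P_def N_def intro!: sum.mono_neutral_right)
  moreover have "sum D (P - N) = (\<Sum>k\<in>P - N. 1)"
    using assms(2) by (intro sum.cong) (force simp: P_def N_def)+
  moreover have "sum D N = (\<Sum>k\<in>N. - 1)"
    using assms(2) by (intro sum.cong) (force simp: P_def N_def)+
  ultimately have sumQ: "sum D Q = int (card P) - 2 * int (card N)" by simp
  then have "even (card P)" using assms(4) by simp
  then have half: "2 * int (card P div 2) = int (card P)" by presburger
  have bound: "\<bar>d k\<bar> \<le> 1" if "k \<in> Q" for k using assms(2,3) that by simp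
  have "card {S \<in> Pow Q. sum d S = c} \<le> 2 ^ card (Q - P) * (card P choose (card P div 2))"
  proof (cases "c + int (card {k \<in> Q. d k < 0}) \<ge> 0")
    case True
    then obtain r where "c + int (card {k \<in> Q. d k < 0}) = int r" using nonneg_int_cases by blast
    then have "card {S \<in> Pow Q. sum d S = c} = 2 ^ card (Q - P) * (card P choose r)"
      using card_subset_sum_eq[of Q d c, OF assms(1) bound] card_Pow_card_Int[OF assms(1) PQ(1)]
      by (simp add: P')
    then show ?thesis by (simp add: binomial_maximum)
  next
    \<comment> \<open>The required cardinality is negative, so no subset qualifies.\<close>
    case False
    then have "{S \<in> Pow Q. int (card (S \<inter> P)) = c + int (card {k \<in> Q. d k < 0})} = {}" by auto
    then have "card {S \<in> Pow Q. sum d S = c} = 0"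
      using card_subset_sum_eq[of Q d c, OF assms(1) bound] by (simp only: P' card.empty)
    then show ?thesis by linarith
  qed
  also have "\<dots> = card {S \<in> Pow Q. card (S \<inter> P) = card P div 2}"
    using card_Pow_card_Int[OF assms(1) PQ(1)] by simp
  also have "\<dots> = card {S \<in> Pow Q. int (card (S \<inter> P)) = (int (card P div 2) - int (card N)) + int (card N)}"
    by simp
  also have "\<dots> = card {S \<in> Pow Q. sum D S = int (card P div 2) - int (card N)}"
    unfolding P_def N_def by (intro card_subset_sum_eq[symmetric] assms)
  also have "{S \<in> Pow Q. sum D S = int (card P div 2) - int (card N)}
               = {S \<in> Pow Q. 2 * sum D S = sum D Q}"
    using half sumQ by auto
  finally show ?thesis .
qed

section \<open>Swapping adjacent heights\<close>

text \<open>The heights $2k-1$ and $2k$ are exactly those with \<open>Suc h div 2 = k\<close>.\<close>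

definition flip_pairs :: "nat set \<Rightarrow> nat \<Rightarrow> nat" where
  "flip_pairs S h = (if Suc h div 2 \<in> S then if odd h then Suc h else h - 1 else h)"

lemma flip_pairs_permutes:
  assumes "S \<subseteq> {1..K}"
  shows "flip_pairs S permutes {1..2*K}"
proof (rule bij_imp_permutes)
  have "flip_pairs S h \<in> {1..2*K}" if "h \<in> {1..2*K}" for h
  proof (cases "odd h \<and> Suc h div 2 \<in> S")
    case True
    then obtain b where b: "h = Suc (2 * b)" by (auto elim: oddE)
    then have "Suc b \<le> K" using True assms by auto
    then show ?thesis using b by (auto simp: flip_pairs_def)
  next
    case False
    then show ?thesis using that by (auto simp: flip_pairs_def elim!: evenE)
  qed
  moreover have "flip_pairs S (flip_pairs S h) = h" if "h \<in> {1..2*K}" for h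
    using that by (cases "odd h") (auto simp: flip_pairs_def)
  ultimately show "bij_betw (flip_pairs S) {1..2*K} {1..2*K}"
    by (intro bij_betw_byWitness[where f' = "flip_pairs S"]) auto
  show "flip_pairs S h = h" if "h \<notin> {1..2*K}" for h
  proof -
    have "Suc h div 2 \<notin> {1..K}" using that by (cases "h = 0") auto
    then show ?thesis using assms by (auto simp: flip_pairs_def)
  qed
qed

text \<open>A flip maps each block of two heights to itself, so it cannot affect comparisons between
  different blocks. Inside a selected block the two heights trade places.\<close>

lemma sgn_flip_pairs:
  assumes "0 \<notin> S"
  shows "sgn (int (flip_pairs S h) - int (flip_pairs S h')) =
    (if Suc h div 2 = Suc h' div 2 \<and> Suc h div 2 \<in> S then - sgn (int h - int h')
     else sgn (int h - int h'))"
proof (cases "Suc h div 2 = Suc h' div 2")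
  case True
  then have "h = h' \<or> odd h \<and> h' = Suc h \<or> odd h' \<and> h = Suc h'" by presburger
  then consider "h = h'" | "odd h" "h' = Suc h" | "odd h'" "h = Suc h'" by blast
  then show ?thesis
    using True by cases (auto simp: flip_pairs_def)
next
  case False
  have pos: "Suc a div 2 \<in> S \<Longrightarrow> a > 0" for a using assms by (cases a) auto
  have same: "Suc (flip_pairs S a) div 2 = Suc a div 2" for a
    using pos[of a] by (auto simp: flip_pairs_def)
  have less: "a < b" if "Suc a div 2 < Suc b div 2" for a b
    using that by (meson Suc_le_mono div_le_mono not_le)
  from False have "Suc h div 2 < Suc h' div 2 \<or> Suc h' div 2 < Suc h div 2" by linarith
  then have "h < h' \<and> flip_pairs S h < flip_pairs S h' \<or> h' < h \<and> flip_pairs S h' < flip_pairs S h"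
    by (metis less same)
  then show ?thesis using False by auto
qed

text \<open>Twice the linking number when \<open>A\<close> and \<open>B\<close> are the arcs of the
  two components and \<open>\<epsilon>\<close> alternates. Arbitrary \<open>A\<close> and
  \<open>B\<close> allow the restriction to a single block.\<close>

definition order_sum :: "nat set \<Rightarrow> nat set \<Rightarrow> (nat \<Rightarrow> int) \<Rightarrow> (nat \<Rightarrow> nat) \<Rightarrow> int" where
  "order_sum A B \<epsilon> \<sigma> = (\<Sum>i\<in>A. \<Sum>j\<in>B. \<epsilon> i * \<epsilon> j * sgn (int (\<sigma> i) - int (\<sigma> j)))"

text \<open>The comparison quantity: for finite \<open>A\<close> it vanishes exactly when half of
  the arcs in \<open>A\<close> lie at odd heights.\<close>

definition odd_excess :: "nat set \<Rightarrow> (nat \<Rightarrow> nat) \<Rightarrow> int" where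
  "odd_excess A \<sigma> = (\<Sum>i\<in>A. if odd (\<sigma> i) then 1 else - 1)"

text \<open>Blocks consist of arcs rather than heights, so that they can be intersected with
  \<open>A\<close> and \<open>B\<close>.\<close>

definition pair_block :: "(nat \<Rightarrow> nat) \<Rightarrow> nat \<Rightarrow> nat set" where
  "pair_block \<sigma> k = {i. Suc (\<sigma> i) div 2 = k}"

text \<open>A flip negates exactly the terms whose two arcs share a block in \<open>S\<close>, and
  negating a term subtracts it twice. Collecting these terms by block gives local order
  sums.\<close>

lemma order_sum_flip_pairs:
  assumes "finite S" "0 \<notin> S" "finite A" "finite B"
  shows "order_sum A B \<epsilon> (flip_pairs S \<circ> \<sigma>) = order_sum A B \<epsilon> \<sigma>
    - 2 * (\<Sum>k\<in>S. order_sum (A \<inter> pair_block \<sigma> k) (B \<inter> pair_block \<sigma> k) \<epsilon> \<sigma>)"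
proof -
  define t where "t = (\<lambda>i j. \<epsilon> i * \<epsilon> j * sgn (int (\<sigma> i) - int (\<sigma> j)))"
  define q where "q = (\<lambda>i. Suc (\<sigma> i) div 2)"
  have "order_sum (A \<inter> pair_block \<sigma> k) (B \<inter> pair_block \<sigma> k) \<epsilon> \<sigma>
      = (\<Sum>i\<in>A. \<Sum>j\<in>B. if k = q i then if q i = q j then t i j else 0 else 0)" for k
    unfolding order_sum_def sum.inter_restrict[OF assms(3)] sum.inter_restrict[OF assms(4)]
    by (intro sum.cong refl) (auto simp: pair_block_def t_def q_def intro!: sum.cong)
  then have "(\<Sum>k\<in>S. order_sum (A \<inter> pair_block \<sigma> k) (B \<inter> pair_block \<sigma> k) \<epsilon> \<sigma>)
      = (\<Sum>k\<in>S. \<Sum>i\<in>A. \<Sum>j\<in>B. if k = q i then if q i = q j then t i j else 0 else 0)"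
    by simp
  also have "\<dots> = (\<Sum>i\<in>A. \<Sum>j\<in>B. \<Sum>k\<in>S. if k = q i then if q i = q j then t i j else 0 else 0)"
    by (subst sum.swap, rule sum.cong, rule refl, subst sum.swap, rule refl)
  \<comment> \<open>For fixed \<open>i\<close> and \<open>j\<close> only the index k = q i can
    contribute.\<close>
  also have "\<dots> = (\<Sum>i\<in>A. \<Sum>j\<in>B. if q i = q j \<and> q i \<in> S then t i j else 0)"
    using assms(1) by (intro sum.cong refl) (simp add: sum.delta)
  finally have "order_sum A B \<epsilon> \<sigma>
    - 2 * (\<Sum>k\<in>S. order_sum (A \<inter> pair_block \<sigma> k) (B \<inter> pair_block \<sigma> k) \<epsilon> \<sigma>)
    = (\<Sum>i\<in>A. \<Sum>j\<in>B. t i j - 2 * (if q i = q j \<and> q i \<in> S then t i j else 0))"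
    by (simp add: order_sum_def t_def sum_subtractf sum_distrib_left)
  also have "\<dots> = order_sum A B \<epsilon> (flip_pairs S \<circ> \<sigma>)"
    unfolding order_sum_def o_def sgn_flip_pairs[OF assms(2)] t_def q_def
    by (intro sum.cong refl) auto
  finally show ?thesis ..
qed

text \<open>A flip reverses the parity of every height in a selected block, which negates the
  contribution of that block.\<close>

lemma odd_excess_flip_pairs:
  assumes "finite S" "0 \<notin> S" "finite A"
  shows "odd_excess A (flip_pairs S \<circ> \<sigma>) = odd_excess A \<sigma>
    - 2 * (\<Sum>k\<in>S. odd_excess (A \<inter> pair_block \<sigma> k) \<sigma>)"
proof -
  define t where "t = (\<lambda>i. if odd (\<sigma> i) then 1 else - 1 :: int)"
  define q where "q = (\<lambda>i. Suc (\<sigma> i) div 2)"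
  have "odd_excess (A \<inter> pair_block \<sigma> k) \<sigma> = (\<Sum>i\<in>A. if k = q i then t i else 0)" for k
    unfolding odd_excess_def sum.inter_restrict[OF assms(3)]
    by (intro sum.cong refl) (auto simp: pair_block_def t_def q_def)
  then have "(\<Sum>k\<in>S. odd_excess (A \<inter> pair_block \<sigma> k) \<sigma>)
      = (\<Sum>k\<in>S. \<Sum>i\<in>A. if k = q i then t i else 0)" by simp
  also have "\<dots> = (\<Sum>i\<in>A. \<Sum>k\<in>S. if k = q i then t i else 0)"
    by (rule sum.swap)
  also have "\<dots> = (\<Sum>i\<in>A. if q i \<in> S then t i else 0)"
    using assms(1) by (intro sum.cong refl) (simp add: sum.delta)
  finally have "odd_excess A \<sigma> - 2 * (\<Sum>k\<in>S. odd_excess (A \<inter> pair_block \<sigma> k) \<sigma>)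
    = (\<Sum>i\<in>A. t i - 2 * (if q i \<in> S then t i else 0))"
    by (simp add: odd_excess_def t_def sum_subtractf sum_distrib_left)
  also have "\<dots> = odd_excess A (flip_pairs S \<circ> \<sigma>)"
    unfolding odd_excess_def o_def t_def q_def
  proof (intro sum.cong refl)
    fix i
    \<comment> \<open>Height 0 is alone in its block and stays even under a flip, so that block must
      not be selected.\<close>
    have "\<sigma> i = 0 \<Longrightarrow> Suc (\<sigma> i) div 2 \<notin> S" using assms(2) by simp
    then show "(if odd (\<sigma> i) then 1 else - 1) - 2 * (if Suc (\<sigma> i) div 2 \<in> S then if odd (\<sigma> i) then 1 else - 1 else 0)
      = (if odd (flip_pairs S (\<sigma> i)) then 1 else - 1 :: int)"
      by (cases "\<sigma> i = 0") (auto simp: flip_pairs_def)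
  qed
  finally show ?thesis ..
qed

lemma pair_block_cases:
  assumes "\<sigma> permutes {1..2*K}" "k \<in> {1..K}"
  obtains x y where "x \<in> {1..2*K}" "y \<in> {1..2*K}" "x \<noteq> y" "\<sigma> x = 2 * k - 1" "\<sigma> y = 2 * k"
    "pair_block \<sigma> k = {x, y}"
proof
  let ?x = "inv \<sigma> (2 * k - 1)" and ?y = "inv \<sigma> (2 * k)"
  have inv: "inv \<sigma> permutes {1..2*K}" using assms(1) by (rule permutes_inv)
  show x: "\<sigma> ?x = 2 * k - 1" and y: "\<sigma> ?y = 2 * k"
    using assms(1) by (simp_all add: permutes_inverses)
  show "?x \<in> {1..2*K}" "?y \<in> {1..2*K}"
    using assms(2) by (subst permutes_in_image[OF inv], force)+
  show "?x \<noteq> ?y" using x y assms(2) by auto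
  have "Suc (\<sigma> i) div 2 = k \<longleftrightarrow> \<sigma> i = 2 * k - 1 \<or> \<sigma> i = 2 * k" for i
    using assms(2) by auto
  also have "\<dots> i \<longleftrightarrow> i = ?x \<or> i = ?y" for i
    using x y permutes_inj[OF assms(1)] by (metis injD)
  finally show "pair_block \<sigma> k = {?x, ?y}" by (auto simp: pair_block_def)
qed

text \<open>A block consists of two arcs at consecutive heights. If both are in \<open>A\<close> or
  both in \<open>B\<close>, the excess is 0 and there is no mixed pair; otherwise both quantities
  are 1 or -1. This is what \<open>card_subset_sum_le_balanced\<close> requires of its two step
  functions.\<close>

lemma
  assumes "\<sigma> permutes {1..2*K}" "k \<in> {1..K}"
    and "A \<union> B = {1..2*K}" "A \<inter> B = {}" "\<And>i. \<epsilon> i \<in> {-1, 1}"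
  shows abs_odd_excess_pair_block_le: "\<bar>odd_excess (A \<inter> pair_block \<sigma> k) \<sigma>\<bar> \<le> 1"
    and abs_order_sum_pair_block: "\<bar>order_sum (A \<inter> pair_block \<sigma> k) (B \<inter> pair_block \<sigma> k) \<epsilon> \<sigma>\<bar>
      = \<bar>odd_excess (A \<inter> pair_block \<sigma> k) \<sigma>\<bar>"
proof -
  obtain x y where xy: "x \<in> A \<union> B" "y \<in> A \<union> B" "x \<noteq> y" "\<sigma> x = 2 * k - 1" "\<sigma> y = 2 * k"
    "pair_block \<sigma> k = {x, y}"
    using pair_block_cases[OF assms(1,2)] assms(3) by metis
  have eps: "\<bar>\<epsilon> i\<bar> = 1" for i using assms(5)[of i] by auto
  have k: "k > 0" using assms(2) by auto
  then have odd: "odd (2 * k - 1)" by simp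
  have sgn: "sgn (int (2 * k - 1) - int (2 * k)) = -1" "sgn (int (2 * k) - int (2 * k - 1)) = 1"
    using k by (auto simp: sgn_if of_nat_diff)
  consider "x \<in> A" "x \<notin> B" "y \<in> A" "y \<notin> B" | "x \<in> A" "x \<notin> B" "y \<notin> A" "y \<in> B"
    | "x \<notin> A" "x \<in> B" "y \<in> A" "y \<notin> B" | "x \<notin> A" "x \<in> B" "y \<notin> A" "y \<in> B"
    using xy(1,2) assms(4) by blast
  then have "\<bar>odd_excess (A \<inter> pair_block \<sigma> k) \<sigma>\<bar> \<le> 1 \<and>
    \<bar>order_sum (A \<inter> pair_block \<sigma> k) (B \<inter> pair_block \<sigma> k) \<epsilon> \<sigma>\<bar>
      = \<bar>odd_excess (A \<inter> pair_block \<sigma> k) \<sigma>\<bar>"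
    using xy(3-5) odd sgn eps
    by cases (simp_all add: xy(6) odd_excess_def order_sum_def abs_mult)
  then show "\<bar>odd_excess (A \<inter> pair_block \<sigma> k) \<sigma>\<bar> \<le> 1"
    "\<bar>order_sum (A \<inter> pair_block \<sigma> k) (B \<inter> pair_block \<sigma> k) \<epsilon> \<sigma>\<bar>
      = \<bar>odd_excess (A \<inter> pair_block \<sigma> k) \<sigma>\<bar>"
    by simp_all
qed

lemma sum_odd_excess_pair_block:
  assumes "\<sigma> permutes {1..2*K}" "A \<subseteq> {1..2*K}"
  shows "(\<Sum>k\<in>{1..K}. odd_excess (A \<inter> pair_block \<sigma> k) \<sigma>) = odd_excess A \<sigma>"
proof -
  have "(\<Union>k\<in>{1..K}. A \<inter> pair_block \<sigma> k) = A"
  proof -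
    have "Suc (\<sigma> i) div 2 \<in> {1..K}" if "i \<in> A" for i
    proof -
      have "\<sigma> i \<in> {1..2*K}" using that assms(2) permutes_in_image[OF assms(1)] by auto
      then show ?thesis by auto
    qed
    then show ?thesis by (auto simp: pair_block_def)
  qed
  moreover have "(\<Sum>i\<in>(\<Union>k\<in>{1..K}. A \<inter> pair_block \<sigma> k). if odd (\<sigma> i) then 1 else - 1 :: int)
    = (\<Sum>k\<in>{1..K}. \<Sum>i\<in>A \<inter> pair_block \<sigma> k. if odd (\<sigma> i) then 1 else - 1)"
    using finite_subset[OF assms(2)] by (intro sum.UNION_disjoint) (auto simp: pair_block_def)
  ultimately show ?thesis by (simp add: odd_excess_def)
qed

lemma even_odd_excess:
  assumes "finite A" "even (card A)"
  shows "even (odd_excess A \<sigma>)"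
proof -
  have "odd_excess A \<sigma> = (\<Sum>i\<in>A. 2 * (if odd (\<sigma> i) then 1 else 0) - 1)"
    unfolding odd_excess_def by (intro sum.cong) auto
  then show ?thesis using assms by (simp add: sum_subtractf flip: sum_distrib_left)
qed

text \<open>For fixed \<open>\<sigma>\<close> both quantities are affine in a subset sum over the
  flipped blocks, with steps \<open>d\<close> and \<open>D\<close> of equal absolute value. The
  excess after the flips vanishes exactly when the sum of \<open>D\<close> over \<open>S\<close> is
  half of its total.\<close>

lemma card_flips_order_sum_le:
  assumes "\<sigma> permutes {1..2*K}"
    and "A \<union> B = {1..2*K}" "A \<inter> B = {}" "\<And>i. \<epsilon> i \<in> {-1, 1}" "even (card A)"
  shows "card {S \<in> Pow {1..K}. order_sum A B \<epsilon> (flip_pairs S \<circ> \<sigma>) = w}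
       \<le> card {S \<in> Pow {1..K}. odd_excess A (flip_pairs S \<circ> \<sigma>) = 0}"
proof -
  define D where "D = (\<lambda>k. odd_excess (A \<inter> pair_block \<sigma> k) \<sigma>)"
  define d where "d = (\<lambda>k. order_sum (A \<inter> pair_block \<sigma> k) (B \<inter> pair_block \<sigma> k) \<epsilon> \<sigma>)"
  have fin: "finite (A \<union> B)" unfolding assms(2) by simp
  have A: "A \<subseteq> {1..2*K}" "finite A" "finite B" using assms(2) fin finite_Un[of A B] by blast+
  have S: "finite S" "0 \<notin> S" if "S \<subseteq> {1..K}" for S
    using that finite_subset by auto
  have sumD: "sum D {1..K} = odd_excess A \<sigma>"
    unfolding D_def by (rule sum_odd_excess_pair_block[OF assms(1) A(1)])
  \<comment> \<open>Only an inclusion: for \<open>w\<close> of the wrong parity the left side is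
    empty, while the rounded quotient may still be a subset sum.\<close>
  have "{S \<in> Pow {1..K}. order_sum A B \<epsilon> (flip_pairs S \<circ> \<sigma>) = w}
    \<subseteq> {S \<in> Pow {1..K}. sum d S = (order_sum A B \<epsilon> \<sigma> - w) div 2}"
    using S A by (auto simp: order_sum_flip_pairs d_def)
  then have "card {S \<in> Pow {1..K}. order_sum A B \<epsilon> (flip_pairs S \<circ> \<sigma>) = w}
    \<le> card {S \<in> Pow {1..K}. sum d S = (order_sum A B \<epsilon> \<sigma> - w) div 2}"
    by (intro card_mono) auto
  also have "\<dots> \<le> card {S \<in> Pow {1..K}. 2 * sum D S = sum D {1..K}}"
    using abs_odd_excess_pair_block_le[OF assms(1) _ assms(2-4)]
      abs_order_sum_pair_block[OF assms(1) _ assms(2-4)] even_odd_excess[OF A(2) assms(5)]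
    by (intro card_subset_sum_le_balanced) (auto simp only: sumD, auto simp: D_def d_def)
  also have "{S \<in> Pow {1..K}. 2 * sum D S = sum D {1..K}}
    = {S \<in> Pow {1..K}. odd_excess A (flip_pairs S \<circ> \<sigma>) = 0}"
    using S A unfolding sumD by (auto simp: odd_excess_flip_pairs D_def)
  finally show ?thesis .
qed

section \<open>Averaging over all permutations\<close>

lemma card_permutes_comp:
  assumes "\<tau> permutes U"
  shows "card {\<sigma>. \<sigma> permutes U \<and> \<Phi> (\<tau> \<circ> \<sigma>)} = card {\<sigma>. \<sigma> permutes U \<and> \<Phi> \<sigma>}"
proof -
  have "bij_betw (\<lambda>\<sigma>. \<tau> \<circ> \<sigma>) {\<sigma>. \<sigma> permutes U \<and> \<Phi> (\<tau> \<circ> \<sigma>)} {\<sigma>. \<sigma> permutes U \<and> \<Phi> \<sigma>}"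
    using assms permutes_inv[OF assms]
    by (intro bij_betw_byWitness[where f' = "\<lambda>\<sigma>. inv \<tau> \<circ> \<sigma>"])
       (auto simp: o_assoc permutes_inv_o intro: permutes_compose)
  then show ?thesis by (rule bij_betw_same_card)
qed

text \<open>Double counting of the pairs of a permutation and a set of flips: composition with a
  fixed flip is a bijection on permutations, so each of the 2^K sets contributes equally. This
  carries the comparison at fixed \<open>\<sigma>\<close> over to all permutations.\<close>

lemma sum_card_flips:
  "(\<Sum>\<sigma> | \<sigma> permutes {1..2*K}. card {S \<in> Pow {1..K}. \<Phi> (flip_pairs S \<circ> \<sigma>)})
    = 2 ^ K * card {\<sigma>. \<sigma> permutes {1..2*K} \<and> \<Phi> \<sigma>}"
proof -
  have "(\<Sum>\<sigma> | \<sigma> permutes {1..2*K}. card {S \<in> Pow {1..K}. \<Phi> (flip_pairs S \<circ> \<sigma>)})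
    = (\<Sum>S\<in>Pow {1..K}. card {\<sigma> \<in> {\<sigma>. \<sigma> permutes {1..2*K}}. \<Phi> (flip_pairs S \<circ> \<sigma>)})"
    by (intro sum_multicount_gen) (auto simp: finite_permutations)
  also have "\<dots> = (\<Sum>S\<in>Pow {1..K}. card {\<sigma>. \<sigma> permutes {1..2*K} \<and> \<Phi> \<sigma>})"
    using flip_pairs_permutes by (intro sum.cong) (auto simp: card_permutes_comp)
  finally show ?thesis by (simp add: card_Pow)
qed

lemma card_order_sum_le_card_balanced:
  assumes "A \<union> B = {1..2*K}" "A \<inter> B = {}" "\<And>i. \<epsilon> i \<in> {-1, 1}" "even (card A)"
  shows "card {\<sigma>. \<sigma> permutes {1..2*K} \<and> order_sum A B \<epsilon> \<sigma> = w}
       \<le> card {\<sigma>. \<sigma> permutes {1..2*K} \<and> odd_excess A \<sigma> = 0}"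
proof -
  have "2 ^ K * card {\<sigma>. \<sigma> permutes {1..2*K} \<and> order_sum A B \<epsilon> \<sigma> = w}
      \<le> 2 ^ K * card {\<sigma>. \<sigma> permutes {1..2*K} \<and> odd_excess A \<sigma> = 0}"
    unfolding sum_card_flips[symmetric]
    using card_flips_order_sum_le[OF _ assms] by (intro sum_mono) auto
  then show ?thesis by simp
qed

section \<open>Counting the balanced permutations\<close>

lemma card_permutes_image:
  assumes "finite U" "A \<subseteq> U"
  shows "card {\<sigma>. \<sigma> permutes U \<and> \<sigma> ` A \<in> F} * (card U choose card A)
    = card {X \<in> F. X \<subseteq> U \<and> card X = card A} * fact (card U)"
proof -
  define f where "f = card {\<sigma>. \<sigma> permutes U \<and> \<sigma> ` A = A}"
  have fibre: "card {\<sigma>. \<sigma> permutes U \<and> \<sigma> ` A = X} = f" if X: "X \<subseteq> U" "card X = card A" for X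
  proof -
    have fin: "finite A" "finite X" using assms X finite_subset by auto
    obtain g where g: "bij_betw g A X" using fin X(2) by (metis finite_same_card_bij)
    have "card (U - A) = card (U - X)" using assms X fin by (simp add: card_Diff_subset)
    then obtain h where h: "bij_betw h (U - A) (U - X)"
      using assms(1) by (metis finite_same_card_bij finite_Diff)
    \<comment> \<open>This permutation of \<open>U\<close> carries \<open>A\<close> onto
      \<open>X\<close>; composing with it matches the stabiliser of \<open>A\<close> with the fibre
      over \<open>X\<close>.\<close>
    define \<tau> where "\<tau> = (\<lambda>i. if i \<in> U then if i \<in> A then g i else h i else i)"
    have "bij_betw \<tau> A X" "bij_betw \<tau> (U - A) (U - X)"
      using g h assms(2) by (subst bij_betw_cong; fastforce simp: \<tau>_def)+
    then have "bij_betw \<tau> (A \<union> (U - A)) (X \<union> (U - X))" by (rule bij_betw_combine) auto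
    moreover have "A \<union> (U - A) = U" "X \<union> (U - X) = U" using assms(2) X by auto
    ultimately have \<tau>: "\<tau> permutes U" by (intro bij_imp_permutes) (auto simp: \<tau>_def)
    have X_eq: "X = \<tau> ` A" using \<open>bij_betw \<tau> A X\<close> by (simp add: bij_betw_def)
    have "(\<tau> \<circ> \<sigma>) ` A = X \<longleftrightarrow> \<sigma> ` A = A" for \<sigma>
      unfolding X_eq image_comp[symmetric]
      by (rule inj_image_eq_iff[OF permutes_inj[OF \<tau>]])
    then show ?thesis
      using card_permutes_comp[OF \<tau>, of "\<lambda>\<sigma>. \<sigma> ` A = X"] by (simp add: f_def)
  qed
  have count: "card {\<sigma>. \<sigma> permutes U \<and> \<sigma> ` A \<in> G} = card {X \<in> G. X \<subseteq> U \<and> card X = card A} * f" for G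
  proof -
    have img: "\<sigma> ` A \<subseteq> U \<and> card (\<sigma> ` A) = card A" if "\<sigma> permutes U" for \<sigma>
      using that assms(2) permutes_image permutes_inj_on card_image by (metis image_mono)
    let ?X = "{X \<in> G. X \<subseteq> U \<and> card X = card A}"
    have "finite ?X" using assms(1) by (auto intro: finite_subset[of _ "Pow U"])
    have "{\<sigma>. \<sigma> permutes U \<and> \<sigma> ` A \<in> G} = (\<Union>X\<in>?X. {\<sigma>. \<sigma> permutes U \<and> \<sigma> ` A = X})"
      using img by auto
    also have "card \<dots> = (\<Sum>X\<in>?X. card {\<sigma>. \<sigma> permutes U \<and> \<sigma> ` A = X})"
      using \<open>finite ?X\<close> finite_permutations[OF assms(1)]
      by (intro card_UN_disjoint) (auto intro: rev_finite_subset)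
    also have "\<dots> = (\<Sum>X\<in>?X. f)" by (intro sum.cong) (auto simp: fibre)
    finally show ?thesis by simp
  qed
  \<comment> \<open>Admitting every set as image counts all permutations, which determines the
    common fibre size \<open>f\<close>.\<close>
  have "fact (card U) = (card U choose card A) * f"
    using count[of UNIV] assms(1) by (simp add: card_permutations n_subsets)
  then show ?thesis by (simp add: count)
qed

text \<open>The odd and the even elements are chosen independently, each from \<open>K\<close>
  candidates.\<close>

lemma card_balanced_subsets:
  "card {X. X \<subseteq> {1..2*K} \<and> card {i \<in> X. odd i} = a \<and> card {i \<in> X. even i} = b}
     = (K choose a) * (K choose b)"
proof -
  define O' where "O' = (\<lambda>k. Suc (2 * k)) ` {..<K}"
  define E where "E = (\<lambda>k. 2 * k) ` {1..K}"
  have OE: "O' = {i \<in> {1..2*K}. odd i}" "E = {i \<in> {1..2*K}. even i}"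
    by (auto simp: O'_def E_def elim!: evenE oddE) presburger
  have card: "card O' = K" "card E = K"
    unfolding O'_def E_def by (subst card_image; auto simp: inj_on_def)+
  have fin: "finite O'" "finite E" by (auto simp: O'_def E_def)
  have "bij_betw (\<lambda>X. ({i \<in> X. odd i}, {i \<in> X. even i}))
     {X. X \<subseteq> {1..2*K} \<and> card {i \<in> X. odd i} = a \<and> card {i \<in> X. even i} = b}
     ({X. X \<subseteq> O' \<and> card X = a} \<times> {X. X \<subseteq> E \<and> card X = b})"
  proof (rule bij_betw_byWitness[where f' = "\<lambda>(X, Y). X \<union> Y"])
    have "{i \<in> X \<union> Y. odd i} = X" "{i \<in> X \<union> Y. even i} = Y" if "X \<subseteq> O'" "Y \<subseteq> E" for X Y
      using that by (auto simp: OE)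
    then show "\<forall>a'\<in>{X. X \<subseteq> O' \<and> card X = a} \<times> {X. X \<subseteq> E \<and> card X = b}.
      (\<lambda>X. ({i \<in> X. odd i}, {i \<in> X. even i})) (case a' of (X, Y) \<Rightarrow> X \<union> Y) = a'"
      "(\<lambda>(X, Y). X \<union> Y) ` ({X. X \<subseteq> O' \<and> card X = a} \<times> {X. X \<subseteq> E \<and> card X = b})
       \<subseteq> {X. X \<subseteq> {1..2*K} \<and> card {i \<in> X. odd i} = a \<and> card {i \<in> X. even i} = b}"
      by (auto simp: OE)
  qed (auto simp: OE)
  then have "card {X. X \<subseteq> {1..2*K} \<and> card {i \<in> X. odd i} = a \<and> card {i \<in> X. even i} = b}
    = card ({X. X \<subseteq> O' \<and> card X = a} \<times> {X. X \<subseteq> E \<and> card X = b})"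
    by (rule bij_betw_same_card)
  then show ?thesis using fin by (simp add: card_cartesian_product n_subsets card)
qed

text \<open>The excess depends only on the image of \<open>A\<close>. As this has 2m elements, zero
  excess means \<open>m\<close> odd and \<open>m\<close> even heights, and
  \<open>card_permutes_image\<close> reduces the claim to counting such sets.\<close>

lemma card_permutes_odd_excess_eq_0:
  assumes "A \<subseteq> {1..2*K}" "card A = 2 * m"
  shows "card {\<sigma>. \<sigma> permutes {1..2*K} \<and> odd_excess A \<sigma> = 0} * (2 * K choose (2 * m))
    = (K choose m)\<^sup>2 * fact (2 * K)"
proof -
  have finA: "finite A" using assms(1) finite_subset by auto
  define F where "F = {X :: nat set. card {i \<in> X. odd i} = m \<and> card {i \<in> X. even i} = m}"
  have "odd_excess A \<sigma> = 0 \<longleftrightarrow> \<sigma> ` A \<in> F" if "\<sigma> permutes {1..2*K}" for \<sigma>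
  proof -
    have fin: "finite (\<sigma> ` A)" using finA by simp
    have inj: "inj_on \<sigma> A" using that by (rule permutes_inj_on)
    have "odd_excess A \<sigma> = (\<Sum>i\<in>\<sigma> ` A. if odd i then 1 else - 1)"
      by (simp add: odd_excess_def sum.reindex[OF inj])
    also have "\<dots> = (\<Sum>i\<in>{i \<in> \<sigma> ` A. odd i}. 1) + (\<Sum>i\<in>{i \<in> \<sigma> ` A. \<not> odd i}. - 1)"
      using fin by (simp add: sum.If_cases Int_def)
    also have "\<dots> = int (card {i \<in> \<sigma> ` A. odd i}) - int (card {i \<in> \<sigma> ` A. even i})"
      by simp
    finally have 1: "odd_excess A \<sigma> = \<dots>" .
    have "2 * m = card (\<sigma> ` A)" using inj by (simp add: card_image assms(2))
    also have "\<dots> = card ({i \<in> \<sigma> ` A. odd i} \<union> {i \<in> \<sigma> ` A. even i})"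
      by (rule arg_cong[where f = card]) auto
    also have "\<dots> = card {i \<in> \<sigma> ` A. odd i} + card {i \<in> \<sigma> ` A. even i}"
      using fin by (intro card_Un_disjoint) auto
    finally show ?thesis using 1 by (auto simp: F_def)
  qed
  then have "{\<sigma>. \<sigma> permutes {1..2*K} \<and> odd_excess A \<sigma> = 0}
      = {\<sigma>. \<sigma> permutes {1..2*K} \<and> \<sigma> ` A \<in> F}" by auto
  moreover have "{X \<in> F. X \<subseteq> {1..2*K} \<and> card X = 2 * m}
      = {X. X \<subseteq> {1..2*K} \<and> card {i \<in> X. odd i} = m \<and> card {i \<in> X. even i} = m}"
  proof -
    have "card X = 2 * m" if "X \<subseteq> {1..2*K}" "X \<in> F" for X
    proof -
      have "finite X" using that finite_subset by auto
      have "card X = card ({i \<in> X. odd i} \<union> {i \<in> X. even i})"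
        by (rule arg_cong[where f = card]) auto
      also have "\<dots> = card {i \<in> X. odd i} + card {i \<in> X. even i}"
        using \<open>finite X\<close> by (intro card_Un_disjoint) auto
      finally show ?thesis using that by (simp add: F_def)
    qed
    then show ?thesis by (auto simp: F_def)
  qed
  ultimately show ?thesis
    using card_permutes_image[of "{1..2*K}" A F] assms
    by (simp add: card_balanced_subsets power2_eq_square del: One_nat_def)
qed

section \<open>Central binomial coefficients\<close>

lemma central_binomial_Suc:
  "real (2 * Suc n choose Suc n) * (real n + 1) = 2 * (2 * real n + 1) * real (2 * n choose n)"
proof -
  define N where "N = real n + 1"
  have N: "N > 0" by (simp add: N_def)
  have "real (2 * Suc n choose Suc n) = fact (2 * n + 2) / (fact (n + 1) * fact (n + 1))"
    by (subst binomial_fact) (auto simp: numeral_2_eq_2)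
  moreover have "real (2 * n choose n) = fact (2 * n) / (fact n * fact n)"
    by (subst binomial_fact) (auto simp: mult_2)
  moreover have "fact (2 * n + 2) = 2 * N * (2 * real n + 1) * fact (2 * n)"
    by (simp add: N_def numeral_2_eq_2 algebra_simps)
  moreover have "fact (n + 1) = N * fact n" by (simp add: N_def)
  ultimately show ?thesis
    unfolding N_def[symmetric] using N by (simp only:) (simp add: divide_simps)
qed

text \<open>Squared to avoid roots. By the recurrence, the induction step reduces to (2n+1)(2n+3)
  \<le> 4(n+1)^2.\<close>

lemma central_binomial_sq_upper: "(2 * real n + 1) * (real (2 * n choose n))\<^sup>2 \<le> 16 ^ n"
proof (induction n)
  case 0
  then show ?case by simp
next
  case (Suc n)
  let ?x = "real (2 * n choose n)" and ?y = "real (2 * Suc n choose Suc n)"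
  have "(2 * real n + 3) * ?y\<^sup>2 * (real n + 1)\<^sup>2 = (2 * real n + 3) * (?y * (real n + 1))\<^sup>2"
    by (simp add: power_mult_distrib)
  also have "\<dots> = 4 * ((2 * real n + 3) * (2 * real n + 1)) * ((2 * real n + 1) * ?x\<^sup>2)"
    by (simp only: central_binomial_Suc) (simp add: power2_eq_square algebra_simps)
  also have "\<dots> \<le> 4 * (4 * (real n + 1)\<^sup>2) * 16 ^ n"
    by (rule mult_mono[OF _ Suc.IH]) (auto simp: power2_eq_square algebra_simps)
  finally have "(2 * real n + 3) * ?y\<^sup>2 * (real n + 1)\<^sup>2 \<le> 16 ^ Suc n * (real n + 1)\<^sup>2"
    by (simp add: mult_ac)
  then have "(2 * real n + 3) * ?y\<^sup>2 \<le> 16 ^ Suc n"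
    by (rule mult_right_le_imp_le) simp
  then show ?case by (simp add: algebra_simps)
qed

text \<open>The induction step reduces to 4n(n+1) \<le> (2n+1)^2, and the base case n = 1 is an
  equality.\<close>

lemma central_binomial_sq_lower:
  "n > 0 \<Longrightarrow> 16 ^ n \<le> 4 * real n * (real (2 * n choose n))\<^sup>2"
proof (induction n rule: nat_induct_non_zero)
  case 1
  then show ?case by (simp add: numeral_2_eq_2)
next
  case (Suc n)
  let ?x = "real (2 * n choose n)" and ?y = "real (2 * Suc n choose Suc n)"
  have "16 ^ Suc n * (real n + 1) \<le> 16 * (4 * real n * ?x\<^sup>2) * (real n + 1)"
    using Suc.IH by simp
  also have "\<dots> = 16 * (4 * real n * (real n + 1)) * ?x\<^sup>2" by simp
  also have "\<dots> \<le> 16 * (2 * real n + 1)\<^sup>2 * ?x\<^sup>2"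
    by (intro mult_right_mono) (auto simp: power2_eq_square algebra_simps)
  also have "\<dots> = 4 * (?y * (real n + 1))\<^sup>2"
    by (simp only: central_binomial_Suc) (simp add: power2_eq_square algebra_simps)
  also have "\<dots> = 4 * (real n + 1) * ?y\<^sup>2 * (real n + 1)"
    by (simp add: power2_eq_square)
  finally have "16 ^ Suc n \<le> 4 * (real n + 1) * ?y\<^sup>2"
    by (rule mult_right_le_imp_le) simp
  then show ?case by (simp add: add.commute)
qed

text \<open>The upper estimates for \<open>x\<close> and \<open>y\<close> and the lower one for
  \<open>z\<close> give (x y / z)^2 \<le> 1/m + 1/n \<le> 2 / min m n. Relaxing 2 to 4 gives a bound
  with a simple square root.\<close>

lemma binomial_sq_div_binomial_double_le:
  assumes "m > 0" "n > 0"
  shows "(real (m + n choose m))\<^sup>2 / real (2 * (m + n) choose (2 * m)) \<le> 2 / sqrt (real (min m n))"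
proof -
  define x y z where "x = real (2 * m choose m)" and "y = real (2 * n choose n)"
    and "z = real (2 * (m + n) choose (m + n))"
  have z: "z > 0" by (simp add: z_def)
  have "x = fact (2*m) / (fact m)\<^sup>2" "y = fact (2*n) / (fact n)\<^sup>2"
    "z = fact (2*(m+n)) / (fact (m+n))\<^sup>2"
    unfolding x_def y_def z_def by (subst binomial_fact; simp add: power2_eq_square mult_2)+
  moreover have "real (m + n choose m) = fact (m + n) / (fact m * fact n)"
    "real (2 * (m + n) choose (2 * m)) = fact (2 * (m + n)) / (fact (2 * m) * fact (2 * n))"
    by (simp_all add: binomial_fact diff_mult_distrib2[symmetric])
  ultimately have eq: "(real (m + n choose m))\<^sup>2 / real (2 * (m + n) choose (2 * m)) = x * y / z"
    by (simp only: power2_eq_square) (simp add: mult_ac)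
  have "x\<^sup>2 * y\<^sup>2 * (4 * real m * real n) \<le> ((2 * real m + 1) * x\<^sup>2) * ((2 * real n + 1) * y\<^sup>2)"
    by (simp add: algebra_simps)
  also have "\<dots> \<le> 16 ^ m * 16 ^ n"
    unfolding x_def y_def by (intro mult_mono central_binomial_sq_upper) auto
  also have "\<dots> \<le> 4 * real (m + n) * z\<^sup>2"
    using central_binomial_sq_lower[of "m + n"] assms by (simp add: z_def power_add)
  finally have "(x * y / z)\<^sup>2 * (real m * real n) \<le> real m + real n"
    using z by (simp add: field_simps power_mult_distrib power_divide)
  also have "\<dots> \<le> 2 * real (max m n)" by simp
  \<comment> \<open>Since m n is the product of minimum and maximum, the maximum can be cancelled
    afterwards.\<close>
  finally have "(x * y / z)\<^sup>2 * real (min m n) * real (max m n) \<le> 2 * real (max m n)"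
    by (simp add: min_def max_def mult_ac split: if_splits)
  then have "(x * y / z)\<^sup>2 * real (min m n) \<le> 2"
    by (rule mult_right_le_imp_le) (use assms in auto)
  then have "(x * y / z)\<^sup>2 \<le> (2 / sqrt (real (min m n)))\<^sup>2"
    using assms by (simp add: power_divide field_simps)
  then have "x * y / z \<le> 2 / sqrt (real (min m n))"
    by (rule power2_le_imp_le) simp
  then show ?thesis by (simp only: eq)
qed

section \<open>The bound\<close>

text \<open>Shifting the arc numbers of the second component by the even number 2m leaves the
  alternating signs unchanged. Doubling clears the factor 1/2, so the counting can take place in the
  integers.\<close>

lemma linking_number_eq_order_sum:
  assumes "m > 0" "n > 0" "petal_diagram m n \<alpha> \<beta> D" "petal_link m n D \<sigma> K" "inj \<sigma>"
  shows "2 * linking_number K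
    = of_int (order_sum {1..2*m} {2*m + 1..2*m + 2*n} (\<lambda>i. (-1) ^ i) \<sigma>)"
proof -
  have sgn_diff: "of_int (sgn (int a - int b)) = sgn (real a - real b)" for a b
    by (simp add: sgn_if)
  have shift: "sum f {2*m + 1..2*m + 2*n} = (\<Sum>j\<in>{1..2*n}. f (2*m + j))" for f :: "nat \<Rightarrow> real"
    using sum.shift_bounds_cl_nat_ivl[of f 1 "2*m" "2*n"] by (simp add: add.commute)
  have "of_int (order_sum {1..2*m} {2*m + 1..2*m + 2*n} (\<lambda>i. (-1) ^ i) \<sigma>)
    = (\<Sum>i\<in>{1..2*m}. \<Sum>j\<in>{2*m + 1..2*m + 2*n}. (-1) ^ i * (-1) ^ j * sgn (real (\<sigma> i) - real (\<sigma> j)))"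
    unfolding order_sum_def of_int_sum of_int_mult of_int_power of_int_minus of_int_1 sgn_diff ..
  also have "\<dots> = (\<Sum>i\<in>{1..2*m}. \<Sum>j\<in>{1..2*n}. (-1) ^ (i + j) * sgn (real (\<sigma> i) - real (\<sigma> (2*m + j))))"
    unfolding shift by (simp add: power_add)
  finally show ?thesis
    using linking_number_petal_link[OF assms] by simp
qed

theorem theorem6:
  fixes m n :: nat and v :: int
    and \<alpha> \<beta> :: "nat \<Rightarrow> real"
    and D :: planar_diagram
    and L :: "(nat \<Rightarrow> nat) \<Rightarrow> link"
  assumes "m > 0" and "n > 0"
    and "petal_diagram m n \<alpha> \<beta> D"
    and "\<And>\<sigma>. \<sigma> permutes {1..2*m + 2*n} \<Longrightarrow> petal_link m n D \<sigma> (L \<sigma>)"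
  shows "measure_pmf.prob (random_petal_link m n L) {K. linking_number K = of_int v}
           \<le> 6 / sqrt (real (min m n))"
proof -
  let ?A = "{1..2*m}" and ?B = "{2*m + 1..2*m + 2*n}" and ?\<epsilon> = "\<lambda>i. (-1) ^ i :: int"
  have twice: "{1..2*m + 2*n} = {1..2 * (m + n)}" by simp
  let ?P = "{\<sigma>. \<sigma> permutes {1..2 * (m + n)}}"
  have P: "finite ?P" "card ?P = fact (2 * (m + n))"
    by (auto simp: finite_permutations card_permutations)
  then have "card ?P \<noteq> 0" by (simp only: fact_nonzero) simp
  then have "?P \<noteq> {}" by (rule contrapos_nn) simp
  have "order_sum ?A ?B ?\<epsilon> \<sigma> = 2 * v"
    if "\<sigma> permutes {1..2 * (m + n)}" "linking_number (L \<sigma>) = of_int v" for \<sigma>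
  proof -
    have "real_of_int (order_sum ?A ?B ?\<epsilon> \<sigma>) = real_of_int (2 * v)"
      using linking_number_eq_order_sum[OF assms(1-3) assms(4)[unfolded twice, OF that(1)] permutes_inj[OF that(1)]]
        that(2) by simp
    then show ?thesis by (simp only: of_int_eq_iff)
  qed
  then have "card (?P \<inter> L -` {K. linking_number K = of_int v})
    \<le> card {\<sigma>. \<sigma> permutes {1..2 * (m + n)} \<and> order_sum ?A ?B ?\<epsilon> \<sigma> = 2 * v}"
    using P(1) by (intro card_mono) auto
  also have "\<dots> \<le> card {\<sigma>. \<sigma> permutes {1..2 * (m + n)} \<and> odd_excess ?A \<sigma> = 0}" (is "_ \<le> ?balanced")
    by (rule card_order_sum_le_card_balanced) (auto simp: minus_one_power_iff)
  finally have le: "card (?P \<inter> L -` {K. linking_number K = of_int v}) \<le> ?balanced" .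
  define b where "b = (2 * (m + n) choose (2 * m))"
  have "b > 0" by (simp add: b_def)
  \<comment> \<open>The count of balanced permutations is an identity without quotients, so
    \<open>b\<close> is multiplied in first and divided out only over the reals.\<close>
  have "card (?P \<inter> L -` {K. linking_number K = of_int v}) * b \<le> ?balanced * b"
    using le by (rule mult_right_mono) simp
  also have "\<dots> = (m + n choose m)\<^sup>2 * fact (2 * (m + n))"
    unfolding b_def by (rule card_permutes_odd_excess_eq_0) auto
  finally have "real (card (?P \<inter> L -` {K. linking_number K = of_int v}) * b)
      \<le> real ((m + n choose m)\<^sup>2 * fact (2 * (m + n)))"
    by (rule of_nat_mono)
  then have "real (card (?P \<inter> L -` {K. linking_number K = of_int v})) / fact (2 * (m + n))
    \<le> (real (m + n choose m))\<^sup>2 / real b"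
    using \<open>b > 0\<close> unfolding of_nat_mult of_nat_power of_nat_fact
    by (simp only: pos_divide_le_eq fact_gt_zero times_divide_eq_left pos_le_divide_eq of_nat_0_less_iff)
  also have "\<dots> \<le> 2 / sqrt (real (min m n))"
    unfolding b_def by (rule binomial_sq_div_binomial_double_le[OF assms(1,2)])
  \<comment> \<open>The argument gives the constant 2, which implies the stated bound.\<close>
  also have "\<dots> \<le> 6 / sqrt (real (min m n))"
    by (intro divide_right_mono) auto
  finally show ?thesis
    unfolding random_petal_link_def twice measure_map_pmf measure_pmf_of_set[OF \<open>?P \<noteq> {}\<close> P(1)] P(2)
    by simp
qed

end
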